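(* Let $T$ be a tree in the set $E$ defined below, and let $k$ be its rank (necessarily even). Then deleting the shallow leaf of $T$ with the AVL deletion algorithm described below performs exactly $k/2$ single rotations and produces an AVL tree of rank $k-1$. Subsequently reinserting the deleted key with the AVL insertion algorithm described below performs $k$ promotions and produces an AVL tree of rank $k$ that belongs to $E$.
   Context: A ranked binary tree is a binary tree in which each node $x$ has a non-negative integer rank $x.r$; a missing node (absent child) has rank $-1$. For a child $x$ with parent $p$, its rank difference is $p.r - x.r$; a child with rank difference $i$ is an $i$-child, and a node whose two children (possibly missing) have rank differences $i \le j$ is an $i,j$ node. An AVL tree is a ranked binary tree in which every node is $1,1$ or $1,2$. The rank of a tree is the rank of its root. Trees are binary search trees with keys in symmetric order; rotations are the standard local restructurings preserving symmetric order. AVL insertion of a key: replace the missing node at the position found by binary search with a new leaf of rank $0$. While some node $p$ has a $0$-child $x$: if the sibling of $x$ is a $1$-child (so $p$ is $0,1$), promote $p$ (increase $p.r$ by $1$) and continue at $p$'s parent; otherwise ($p$ is $0,2$) let $z$ be the child of $x$ on the side opposite to $x$'s side relative to $p$: if $z$ is missing or a $2$-child of $x$, do a single rotation at $x$ (making $x$ the parent of $p$) and decrease $p.r$ by $1$, stop; otherwise do a double rotation making $z$ the parent of $x$ and $p$, increase $z.r$ by $1$, decrease $x.r$ and $p.r$ by $1$, stop. AVL deletion of a leaf: replace it by a missing node (ranks unchanged). While there is a violating node $p$ (a $2,2$ node or a $1,3$ node): if $p$ is $2,2$, demote $p$ (decrease $p.r$ by $1$) and continue at $p$'s parent. If $p$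 is $1,3$, let $y$ be its $1$-child, rank $p.r = r$. If $y$ is $1,1$: single rotation at $y$ (making $y$ the parent of $p$), decrease $p.r$ by $1$ and increase $y.r$ by $1$, stop. If $y$ is $1,2$ and its child on the same side as $y$ relative to $p$ (outer child) is a $1$-child: single rotation at $y$, decrease $p.r$ by $2$ (so $p$ becomes $1,1$ of rank $r-2$ and $y$ becomes $1,1$ of rank $r-1$), and continue at $y$'s new parent. Otherwise ($y$ is $1,2$ with inner child $z$ a $1$-child): double rotation making $z$ the parent of $y$ and $p$, with $z.r = r-1$, $y.r = r-2$, $p.r = r-2$, and continue at $z$'s new parent. The set $E$ is the smallest set of AVL trees that contains the one-node tree of rank $0$ and has the following closure property: whenever $A$, $B$, $C$ are AVL trees all of the same rank $k$ with $A, C \in E$, the following two trees of rank $k+2$ are in $E$: (type $L$) a root of rank $k+2$ whose left child has rank $k+1$ with left subtree $A$ and right subtree $B$, and whose right subtree is $C$; (type $R$) a root of rank $k+2$ whose left subtree is $A$ and whose right child has rank $k+1$ with left subtree $B$ and right subtree $C$. For $T \in E$, the shallow leaf of $T$ is the leaf $z$ such that every node on the path from $z$ to the root, other than the root itself, is a $2$-child; in every tree of $E$ this leaf exists and is unique.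
   Formalization: In the closure property of E the middle subtree B has rank k−1 (missing if k=0) instead of rank k; with rank k the claim fails for every tree of E of rank at least 2, since the 1-child of the root is then 1,1 and the first rotation stops without lowering the rank. *)

theory Defs
  imports "HOL-Library.Tree"
begin

text \<open>A node stores its key and its rank. The constructor \<open>Leaf\<close> of the library type plays the role
of a missing node; a leaf in the usual sense is a node of the form \<open>\<langle>Leaf, (a, r), Leaf\<rangle>\<close>.\<close>

type_synonym 'a rtree = "('a \<times> nat) tree"

fun rank :: "'a rtree \<Rightarrow> int" where
  "rank Leaf = - 1"
| "rank (Node l (a, r) u) = int r"

fun ij_node :: "int \<Rightarrow> int \<Rightarrow> 'a rtree \<Rightarrow> bool" where
  "ij_node i j Leaf \<longleftrightarrow> False"
| "ij_node i j (Node l (a, r) u) \<longleftrightarrow>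
     (int r - rank l = i \<and> int r - rank u = j) \<or> (int r - rank l = j \<and> int r - rank u = i)"

fun rank_rule :: "'a rtree \<Rightarrow> bool" where
  "rank_rule Leaf \<longleftrightarrow> True"
| "rank_rule (Node l n u) \<longleftrightarrow>
     (ij_node 1 1 (Node l n u) \<or> ij_node 1 2 (Node l n u)) \<and> rank_rule l \<and> rank_rule u"

definition symmetric_order :: "('a::linorder) rtree \<Rightarrow> bool" where
  "symmetric_order t \<longleftrightarrow> bst (map_tree fst t)"

definition avl :: "('a::linorder) rtree \<Rightarrow> bool" where
  "avl t \<longleftrightarrow> symmetric_order t \<and> rank_rule t"


datatype operation = Promotion | Demotion | Single_Rotation | Double_Rotation

text \<open>Both algorithms return the resulting tree together with the list of rebalancing steps they
performed, in order. The ancestors of the inserted or deleted node are visited bottom-up, and the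
step functions below leave a node that is not violating unchanged. After a terminating step the
subtree has the same rank as before the update, so no further ancestor is violating.
The truncated subtractions on ranks are exact in the branches in which they occur, as long as the
tree was an AVL tree before the update.\<close>

fun insert_step :: "'a rtree \<Rightarrow> 'a rtree \<times> operation list" where
  "insert_step Leaf = (Leaf, [])"
| "insert_step (Node l (p, r) u) =
    (if int r - rank l = 0 then
       (if int r - rank u = 1 then (Node l (p, r + 1) u, [Promotion])
        else (case l of
            Leaf \<Rightarrow> (Node l (p, r) u, [])
          | Node a (x, rx) z \<Rightarrow>
              (if z = Leaf \<or> int rx - rank z = 2
               then (Node a (x, rx) (Node z (p, r - 1) u), [Single_Rotation])
               else (case z of
                   Leaf \<Rightarrow> (Node l (p, r) u, [])
                 | Node b (z', rz) c \<Rightarrow>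
                     (Node (Node a (x, rx - 1) b) (z', rz + 1) (Node c (p, r - 1) u),
                      [Double_Rotation])))))
     else if int r - rank u = 0 then
       (if int r - rank l = 1 then (Node l (p, r + 1) u, [Promotion])
        else (case u of
            Leaf \<Rightarrow> (Node l (p, r) u, [])
          | Node z (x, rx) a \<Rightarrow>
              (if z = Leaf \<or> int rx - rank z = 2
               then (Node (Node l (p, r - 1) z) (x, rx) a, [Single_Rotation])
               else (case z of
                   Leaf \<Rightarrow> (Node l (p, r) u, [])
                 | Node c (z', rz) b \<Rightarrow>
                     (Node (Node l (p, r - 1) c) (z', rz + 1) (Node b (x, rx - 1) a),
                      [Double_Rotation])))))
     else (Node l (p, r) u, []))"

fun avl_insert :: "'a::linorder \<Rightarrow> 'a rtree \<Rightarrow> 'a rtree \<times> operation list" where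
  "avl_insert x Leaf = (Node Leaf (x, 0) Leaf, [])"
| "avl_insert x (Node l (p, r) u) =
    (if x < p then
       (let (l', ops) = avl_insert x l; (t, ops') = insert_step (Node l' (p, r) u)
        in (t, ops @ ops'))
     else if p < x then
       (let (u', ops) = avl_insert x u; (t, ops') = insert_step (Node l (p, r) u')
        in (t, ops @ ops'))
     else (Node l (p, r) u, []))"

fun delete_step :: "'a rtree \<Rightarrow> 'a rtree \<times> operation list" where
  "delete_step Leaf = (Leaf, [])"
| "delete_step (Node l (p, r) u) =
    (if ij_node 2 2 (Node l (p, r) u) then (Node l (p, r - 1) u, [Demotion])
     else if int r - rank l = 1 \<and> int r - rank u = 3 then
       (case l of
          Leaf \<Rightarrow> (Node l (p, r) u, [])
        | Node a (y, ry) z \<Rightarrow>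
            (if ij_node 1 1 l
             then (Node a (y, ry + 1) (Node z (p, r - 1) u), [Single_Rotation])
             else if ij_node 1 2 l \<and> int ry - rank a = 1
             then (Node a (y, ry) (Node z (p, r - 2) u), [Single_Rotation])
             else (case z of
                 Leaf \<Rightarrow> (Node l (p, r) u, [])
               | Node b (z', rz) c \<Rightarrow>
                   (Node (Node a (y, r - 2) b) (z', r - 1) (Node c (p, r - 2) u),
                    [Double_Rotation]))))
     else if int r - rank u = 1 \<and> int r - rank l = 3 then
       (case u of
          Leaf \<Rightarrow> (Node l (p, r) u, [])
        | Node z (y, ry) a \<Rightarrow>
            (if ij_node 1 1 u
             then (Node (Node l (p, r - 1) z) (y, ry + 1) a, [Single_Rotation])
             else if ij_node 1 2 u \<and> int ry - rank a = 1
             then (Node (Node l (p, r - 2) z) (y, ry) a, [Single_Rotation])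
             else (case z of
                 Leaf \<Rightarrow> (Node l (p, r) u, [])
               | Node c (z', rz) b \<Rightarrow>
                   (Node (Node l (p, r - 2) c) (z', r - 1) (Node b (y, r - 2) a),
                    [Double_Rotation]))))
     else (Node l (p, r) u, []))"


text \<open>Nodes are addressed by the directions taken from the root.\<close>

datatype direction = To_Left | To_Right

fun subtree_at :: "direction list \<Rightarrow> 'a rtree \<Rightarrow> 'a rtree" where
  "subtree_at [] t = t"
| "subtree_at (d # ds) Leaf = Leaf"
| "subtree_at (To_Left # ds) (Node l n u) = subtree_at ds l"
| "subtree_at (To_Right # ds) (Node l n u) = subtree_at ds u"

definition key_at :: "direction list \<Rightarrow> 'a rtree \<Rightarrow> 'a" where
  "key_at ds t = (case subtree_at ds t of Node l (a, r) u \<Rightarrow> a)"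

text \<open>Meaningful only if the path leads to a node without children.\<close>

fun avl_delete_leaf :: "direction list \<Rightarrow> 'a rtree \<Rightarrow> 'a rtree \<times> operation list" where
  "avl_delete_leaf [] t = (Leaf, [])"
| "avl_delete_leaf (d # ds) Leaf = (Leaf, [])"
| "avl_delete_leaf (To_Left # ds) (Node l n u) =
    (let (l', ops) = avl_delete_leaf ds l; (t, ops') = delete_step (Node l' n u)
     in (t, ops @ ops'))"
| "avl_delete_leaf (To_Right # ds) (Node l n u) =
    (let (u', ops) = avl_delete_leaf ds u; (t, ops') = delete_step (Node l n u')
     in (t, ops @ ops'))"


text \<open>The middle subtree \<open>B\<close> has rank \<open>k - 1\<close>, so it is missing if \<open>k = 0\<close>. The source states rank
\<open>k\<close> for all of \<open>A\<close>, \<open>B\<close> and \<open>C\<close>; with that rank the child of rank \<open>k + 1\<close> is a \<open>1,1\<close> node, so the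
first rotation of the deletion is a terminating one, the rank of the tree does not drop, and the
theorem already fails for the trees of rank \<open>2\<close>.\<close>

inductive_set E :: "('a::linorder) rtree set" where
  one_node: "Node Leaf (x, 0) Leaf \<in> E"
| type_L: "\<lbrakk>avl A; avl B; avl C; rank A = int k; rank B = int k - 1; rank C = int k; A \<in> E; C \<in> E;
     symmetric_order (Node (Node A (x, k + 1) B) (y, k + 2) C)\<rbrakk>
    \<Longrightarrow> Node (Node A (x, k + 1) B) (y, k + 2) C \<in> E"
| type_R: "\<lbrakk>avl A; avl B; avl C; rank A = int k; rank B = int k - 1; rank C = int k; A \<in> E; C \<in> E;
     symmetric_order (Node A (x, k + 2) (Node B (y, k + 1) C))\<rbrakk>
    \<Longrightarrow> Node A (x, k + 2) (Node B (y, k + 1) C) \<in> E"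

definition is_shallow_leaf :: "'a rtree \<Rightarrow> direction list \<Rightarrow> bool" where
  "is_shallow_leaf t ds \<longleftrightarrow>
     (\<exists>a r. subtree_at ds t = Node Leaf (a, r) Leaf) \<and>
     (\<forall>ds1 d ds2. ds = ds1 @ d # ds2 \<longrightarrow>
        rank (subtree_at ds1 t) - rank (subtree_at (ds1 @ [d]) t) = 2)"

definition shallow_leaf :: "'a rtree \<Rightarrow> direction list" where
  "shallow_leaf t = (THE ds. is_shallow_leaf t ds)"

end

theory Submission
  imports Defs
begin

text \<open>The shallow leaf of a type \<open>L\<close> tree is that of \<open>C\<close>. By induction, deleting it lowers the rank of
\<open>C\<close> by one, so the root becomes a \<open>1,3\<close> node whose left child is \<open>1,2\<close> with outer \<open>1\<close>-child \<open>A\<close>, and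
one single rotation yields a tree of rank \<open>k + 1\<close> in which \<open>C\<close> hangs below two right edges. The
reinsertion restores the rank of \<open>C\<close> and then promotes both nodes above it, which gives a type \<open>R\<close>
tree. The other case is the mirror image, so each round exchanges the types along the path.\<close>

abbreviation keys :: "'a rtree \<Rightarrow> 'a set" where
  "keys t \<equiv> fst ` set_tree t"

lemma symmetric_order_Leaf [simp]: "symmetric_order Leaf"
  by (simp add: symmetric_order_def)

lemma symmetric_order_Node [simp]:
  "symmetric_order (Node l (x, r) u) \<longleftrightarrow>
    symmetric_order l \<and> symmetric_order u \<and> (\<forall>y\<in>keys l. y < x) \<and> (\<forall>y\<in>keys u. x < y)"
  by (auto simp: symmetric_order_def tree.set_map)

text \<open>Both nodes that a rule adds have rank differences \<open>1\<close> and \<open>2\<close>,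
  and the symmetric order of the whole tree is a premise.\<close>

lemma E_avl: "T \<in> E \<Longrightarrow> avl T"
  by (induction rule: E.induct) (auto simp: avl_def)

lemma E_even_rank: "T \<in> E \<Longrightarrow> even (rank T)"
  by (induction rule: E.induct) auto

lemma not_is_shallow_leaf_Leaf [simp]: "\<not> is_shallow_leaf Leaf ds"
  by (cases ds) (auto simp: is_shallow_leaf_def)

lemma is_shallow_leaf_Nil [simp]:
  "is_shallow_leaf t [] \<longleftrightarrow> (\<exists>a r. t = Node Leaf (a, r) Leaf)"
  by (auto simp: is_shallow_leaf_def)

text \<open>A split of a nonempty path at an edge either takes the first edge, with an empty prefix,
  or splits the rest. This makes the path condition of \<open>is_shallow_leaf\<close>
  recursive.\<close>

lemma all_Cons_eq_append_conv:
  "(\<forall>ds1 d ds2. e # es = ds1 @ d # ds2 \<longrightarrow> P ds1 d) \<longleftrightarrow>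
    P [] e \<and> (\<forall>ds1 d ds2. es = ds1 @ d # ds2 \<longrightarrow> P (e # ds1) d)"
  by (auto simp: Cons_eq_append_conv)

lemma is_shallow_leaf_Cons [simp]:
  "is_shallow_leaf (Node l n u) (To_Left # ds) \<longleftrightarrow>
    rank (Node l n u) - rank l = 2 \<and> is_shallow_leaf l ds"
  "is_shallow_leaf (Node l n u) (To_Right # ds) \<longleftrightarrow>
    rank (Node l n u) - rank u = 2 \<and> is_shallow_leaf u ds"
  unfolding is_shallow_leaf_def all_Cons_eq_append_conv by auto

text \<open>The node of \<open>x\<close> is a \<open>1\<close>-child of the root, so a shallow path
  must go to the \<open>2\<close>-child \<open>C\<close>.\<close>

lemma is_shallow_leaf_type_L:
  assumes "rank A = int k" "rank C = int k"
  shows "is_shallow_leaf (Node (Node A (x, k + 1) B) (y, k + 2) C) ds \<longleftrightarrow>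
    (\<exists>es. ds = To_Right # es \<and> is_shallow_leaf C es)"
proof (cases ds)
  case (Cons d es)
  then show ?thesis using assms by (cases d) auto
qed simp

lemma is_shallow_leaf_type_R:
  assumes "rank A = int k" "rank C = int k"
  shows "is_shallow_leaf (Node A (x, k + 2) (Node B (y, k + 1) C)) ds \<longleftrightarrow>
    (\<exists>es. ds = To_Left # es \<and> is_shallow_leaf A es)"
proof (cases ds)
  case (Cons d es)
  then show ?thesis using assms by (cases d) auto
qed simp

lemma E_ex1_shallow_leaf: "T \<in> E \<Longrightarrow> \<exists>!ds. is_shallow_leaf T ds"
proof (induction rule: E.induct)
  case (one_node x)
  show ?case
  proof (rule ex1I[of _ "[]"])
    fix ds assume "is_shallow_leaf (Node Leaf (x, 0) Leaf) ds"
    then show "ds = []"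
    proof (cases ds)
      case (Cons d es)
      with \<open>is_shallow_leaf _ ds\<close> show ?thesis by (cases d) auto
    qed
  qed simp
next
  case (type_L A B C k x y)
  then show ?case unfolding is_shallow_leaf_type_L[OF type_L.hyps(4,6)] by blast
next
  case (type_R A B C k x y)
  then show ?case unfolding is_shallow_leaf_type_R[OF type_R.hyps(4,6)] by blast
qed

lemma shallow_leaf_eqI: "T \<in> E \<Longrightarrow> is_shallow_leaf T ds \<Longrightarrow> shallow_leaf T = ds"
  unfolding shallow_leaf_def using E_ex1_shallow_leaf by (metis the1_equality)

lemma is_shallow_leaf_shallow_leaf: "T \<in> E \<Longrightarrow> is_shallow_leaf T (shallow_leaf T)"
  unfolding shallow_leaf_def by (rule theI') (rule E_ex1_shallow_leaf)

lemma key_at_simps [simp]: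
  "key_at (To_Left # ds) (Node l n u) = key_at ds l"
  "key_at (To_Right # ds) (Node l n u) = key_at ds u"
  by (simp_all add: key_at_def)

text \<open>Lets the deleted key be compared with the keys above its leaf, which fixes the search
  path of the reinsertion.\<close>

lemma key_at_in_keys: "is_shallow_leaf t ds \<Longrightarrow> key_at ds t \<in> keys t"
proof (induction t arbitrary: ds)
  case (Node l n u)
  show ?case
  proof (cases ds)
    case Nil
    with Node.prems show ?thesis by (auto simp: key_at_def split: prod.split)
  next
    case (Cons d es)
    then show ?thesis using Node by (cases d) auto
  qed
qed simp

text \<open>The inclusions between key sets are what carries the symmetric order through the induction.\<close>

lemma E_delete_reinsert:
  assumes "T \<in> E"
  shows "\<exists>T' T'' del_ops ins_ops.
    avl_delete_leaf (shallow_leaf T) T = (T', del_ops) \<and>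
    avl_insert (key_at (shallow_leaf T) T) T' = (T'', ins_ops) \<and>
    2 * int (count_list del_ops Single_Rotation) = rank T \<and>
    avl T' \<and> rank T' = rank T - 1 \<and> keys T' \<subseteq> keys T \<and>
    int (count_list ins_ops Promotion) = rank T \<and>
    T'' \<in> E \<and> rank T'' = rank T \<and> keys T'' \<subseteq> keys T"
  using assms
proof (induction rule: E.induct)
  case (one_node x)
  have "shallow_leaf (Node Leaf (x, 0) Leaf) = []"
    by (rule shallow_leaf_eqI) (auto intro: E.one_node)
  then show ?case by (auto simp: key_at_def avl_def intro: E.one_node)
next
  case (type_L A B C k x y)
  let ?T = "Node (Node A (x, k + 1) B) (y, k + 2) C"
  define c where "c = key_at (shallow_leaf C) C"
  obtain C' C'' dops iops where IH:
    "avl_delete_leaf (shallow_leaf C) C = (C', dops)" "avl_insert c C' = (C'', iops)"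
    "2 * int (count_list dops Single_Rotation) = int k"
    "avl C'" "rank C' = int k - 1" "keys C' \<subseteq> keys C"
    "int (count_list iops Promotion) = int k"
    "C'' \<in> E" "rank C'' = int k" "keys C'' \<subseteq> keys C"
    using type_L unfolding c_def by auto
  have leaf: "is_shallow_leaf C (shallow_leaf C)"
    using type_L by (simp add: is_shallow_leaf_shallow_leaf)
  have sl: "shallow_leaf ?T = To_Right # shallow_leaf C"
    using type_L leaf by (intro shallow_leaf_eqI E.type_L) simp_all
  have "c \<in> keys C" unfolding c_def using leaf by (rule key_at_in_keys)
  have "x < y" using type_L.hyps(9) by simp
  then have bound: "\<forall>z\<in>keys C. x < z \<and> y < z"
    using type_L.hyps(9) by (auto intro: less_trans)
  then have bounds: "\<forall>z\<in>keys C'. x < z \<and> y < z" "\<forall>z\<in>keys C''. x < z \<and> y < z"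
    using IH(6,10) by blast+
  have "x < c" "y < c" using bound \<open>c \<in> keys C\<close> by blast+
  \<comment> \<open>The rotation lowers \<open>y\<close> by \<open>2\<close>. Its children
    \<open>B\<close> and \<open>C'\<close> have rank \<open>k - 1\<close>, and both children of
    \<open>x\<close> have rank \<open>k\<close>, so \<open>x\<close> and \<open>y\<close> become
    \<open>1,1\<close> nodes.\<close>
  let ?T' = "Node A (x, k + 1) (Node B (y, k) C')"
  let ?T'' = "Node A (x, k + 2) (Node B (y, k + 1) C'')"
  have "avl_delete_leaf (shallow_leaf ?T) ?T = (?T', dops @ [Single_Rotation])"
    unfolding sl using type_L.hyps IH by simp
  \<comment> \<open>The search passes \<open>x\<close> and \<open>y\<close> to the right. Once
    \<open>C''\<close> is back at rank \<open>k\<close>, \<open>y\<close> is a \<open>0,1\<close>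
    node; its promotion makes \<open>x\<close> one too.\<close>
  moreover have "avl_insert (key_at (shallow_leaf ?T) ?T) ?T' = (?T'', iops @ [Promotion, Promotion])"
    unfolding sl key_at_simps c_def[symmetric]
    using type_L.hyps(4,5,6) IH(2,9) \<open>x < c\<close> \<open>y < c\<close> \<open>x < c\<close>[THEN less_not_sym] \<open>y < c\<close>[THEN less_not_sym] by simp
  moreover have "avl ?T'"
    using type_L.hyps(1-6,9) IH(4,5) bounds(1) \<open>x < y\<close> by (auto simp: avl_def)
  moreover have "?T'' \<in> E"
    using type_L.hyps IH(8,9) E_avl[OF IH(8)] bounds(2) \<open>x < y\<close>
    by (intro E.type_R) (auto simp: avl_def)
  \<comment> \<open>One rotation and two promotions are added while the rank grows from
    \<open>k\<close> to \<open>k + 2\<close>.\<close>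
  ultimately show ?case using IH by auto
next
  case (type_R A B C k x y)
  let ?T = "Node A (x, k + 2) (Node B (y, k + 1) C)"
  define a where "a = key_at (shallow_leaf A) A"
  obtain A' A'' dops iops where IH:
    "avl_delete_leaf (shallow_leaf A) A = (A', dops)" "avl_insert a A' = (A'', iops)"
    "2 * int (count_list dops Single_Rotation) = int k"
    "avl A'" "rank A' = int k - 1" "keys A' \<subseteq> keys A"
    "int (count_list iops Promotion) = int k"
    "A'' \<in> E" "rank A'' = int k" "keys A'' \<subseteq> keys A"
    using type_R unfolding a_def by auto
  have leaf: "is_shallow_leaf A (shallow_leaf A)"
    using type_R by (simp add: is_shallow_leaf_shallow_leaf)
  have sl: "shallow_leaf ?T = To_Left # shallow_leaf A"
    using type_R leaf by (intro shallow_leaf_eqI E.type_R) simp_all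
  have "a \<in> keys A" unfolding a_def using leaf by (rule key_at_in_keys)
  have "x < y" using type_R.hyps(9) by simp
  then have bound: "\<forall>z\<in>keys A. z < x \<and> z < y"
    using type_R.hyps(9) by (auto intro: less_trans)
  then have bounds: "\<forall>z\<in>keys A'. z < x \<and> z < y" "\<forall>z\<in>keys A''. z < x \<and> z < y"
    using IH(6,10) by blast+
  have "a < x" "a < y" using bound \<open>a \<in> keys A\<close> by blast+
  \<comment> \<open>Mirror image: the rotation makes \<open>y\<close> the root and lowers
    \<open>x\<close> to rank \<open>k\<close>; two promotions then give a type \<open>L\<close>
    tree.\<close>
  let ?T' = "Node (Node A' (x, k) B) (y, k + 1) C"
  let ?T'' = "Node (Node A'' (x, k + 1) B) (y, k + 2) C"
  have "avl_delete_leaf (shallow_leaf ?T) ?T = (?T', dops @ [Single_Rotation])"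
    unfolding sl using type_R.hyps IH by simp
  moreover have "avl_insert (key_at (shallow_leaf ?T) ?T) ?T' = (?T'', iops @ [Promotion, Promotion])"
    unfolding sl key_at_simps a_def[symmetric]
    using type_R.hyps(4,5,6) IH(2,9) \<open>a < x\<close> \<open>a < y\<close> by simp
  moreover have "avl ?T'"
    using type_R.hyps(1-6,9) IH(4,5) bounds(1) \<open>x < y\<close> by (auto simp: avl_def)
  moreover have "?T'' \<in> E"
    using type_R.hyps IH(8,9) E_avl[OF IH(8)] bounds(2) \<open>x < y\<close>
    by (intro E.type_L) (auto simp: avl_def)
  ultimately show ?case using IH by auto
qed

theorem theorem2:
  fixes T T' T'' :: "('a::linorder) rtree" and k :: int
    and del_ops ins_ops :: "operation list"
  assumes "T \<in> E" and "rank T = k"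
    and "avl_delete_leaf (shallow_leaf T) T = (T', del_ops)"
    and "avl_insert (key_at (shallow_leaf T) T) T' = (T'', ins_ops)"
  shows "even k
    \<and> int (count_list del_ops Single_Rotation) = k div 2
    \<and> avl T' \<and> rank T' = k - 1
    \<and> int (count_list ins_ops Promotion) = k
    \<and> avl T'' \<and> rank T'' = k \<and> T'' \<in> E"
  \<comment> \<open>Both algorithms are functions, so the given trees and lists are the witnesses of
    the lemma. Its doubled rotation count yields \<open>k div 2\<close>.\<close>
  using E_delete_reinsert[OF assms(1)] E_even_rank[OF assms(1)] E_avl assms by auto

end
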